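(* Consider the $GI/M/1/n$ queueing system with fixed interarrival distribution function $A$ and fixed service rate $\mu$ (the same for all $n$), and let $p_n$ be its loss probability. Assume that $\rho=1$ and $\rho_3<\infty$. Then as $n\to\infty$ $$p_n=\frac{\rho_2}{2n}+O\Big(\frac{\log n}{n^2}\Big).$$
   Context: $GI/M/1/n$ queue: a single-server loss system in which interarrival times are i.i.d. nonnegative random variables with distribution function $A(x)$ having mean $1/\lambda$, $0<\lambda<\infty$; service times are i.i.d. exponential with parameter $\mu>0$, independent of arrivals; the system holds at most $n$ customers (the buffer size $n$ includes the position at the server), and customers arriving when the system is full are lost. Notation: $\alpha(s)=\int_0^\infty e^{-sx}\,dA(x)$; $\rho=\lambda/\mu$; $\rho_m=\mu^m\int_0^\infty x^m\,dA(x)$ for $m=1,2,\dots$ (so $\rho_1=\rho^{-1}$). The loss probability $p_n$ is the stationary probability that an arriving customer finds the system full. It exists for every value of $\rho$ and is given by $$p_n=\frac{1}{\sum_{j=0}^n\pi_j},\qquad \sum_{j=0}^\infty\pi_jz^j=\frac{(1-z)\,\alpha(\mu-\mu z)}{\alpha(\mu-\mu z)-z},\quad |z|<\sigma,$$ where $\sigma$ is the minimum nonnegative solution of $z=\alpha(\mu-\mu z)$; $\sigma\in(0,1)$ if $\lambda<\mu$ and $\sigma=1$ otherwise. *)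

theory Defs
  imports "HOL-Probability.Probability" "HOL-Library.Landau_Symbols"
begin

text \<open>
  The GI/M/1/n queue is observed at arrival epochs.  An interarrival time has law \<open>A\<close>
  and a service time is exponential with rate \<open>\<mu>\<close>.  Immediately after an arrival, the residual
  service time of the customer at the server is again exponential with rate \<open>\<mu>\<close> and independent
  of the past (lack of memory), so the number of customers found by successive arrivals is a Markov
  chain on \<open>{0..n}\<close>, and one step of it is driven by a fresh interarrival time and a fresh
  sequence of i.i.d. exponential service times.
\<close>

definition step_law :: "real measure \<Rightarrow> real \<Rightarrow> (real \<times> (nat \<Rightarrow> real)) measure" where
  "step_law A \<mu> =
     A \<Otimes>\<^sub>M (\<Pi>\<^sub>M i\<in>(UNIV :: nat set). density lborel (\<lambda>x. ennreal (exponential_density \<mu> x)))"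

text \<open>
  Number of customers left after time \<open>t\<close> when \<open>m\<close> customers are initially present,
  none arrives, and they are served one after another, with (remaining) service times
  \<open>s 0, s 1, \<dots>\<close>: the \<open>d\<close>-th departure takes place at time \<open>\<Sum>i<d. s i\<close>.
\<close>

definition remaining :: "nat \<Rightarrow> real \<Rightarrow> (nat \<Rightarrow> real) \<Rightarrow> nat" where
  "remaining m t s = m - card {d \<in> {1..m}. (\<Sum>i<d. s i) \<le> t}"

text \<open>
  An arrival that finds \<open>i\<close> customers leaves \<open>min (i + 1) n\<close> customers in the system: it is
  admitted if \<open>i < n\<close> and lost if \<open>i = n\<close>.
\<close>

definition trans_prob :: "real measure \<Rightarrow> real \<Rightarrow> nat \<Rightarrow> nat \<Rightarrow> nat \<Rightarrow> real" where
  "trans_prob A \<mu> n i j =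
     measure (step_law A \<mu>)
       {\<omega> \<in> space (step_law A \<mu>). remaining (min (i + 1) n) (fst \<omega>) (snd \<omega>) = j}"

definition stationary :: "real measure \<Rightarrow> real \<Rightarrow> nat \<Rightarrow> (nat \<Rightarrow> real) \<Rightarrow> bool" where
  "stationary A \<mu> n q \<longleftrightarrow>
     (\<forall>i\<le>n. 0 \<le> q i) \<and> (\<Sum>i\<le>n. q i) = 1 \<and>
     (\<forall>j\<le>n. q j = (\<Sum>i\<le>n. q i * trans_prob A \<mu> n i j))"

definition loss_prob :: "real measure \<Rightarrow> real \<Rightarrow> nat \<Rightarrow> real" where
  "loss_prob A \<mu> n = (THE p. \<exists>q. stationary A \<mu> n q \<and> p = q n)"

definition scaled_moment :: "real measure \<Rightarrow> real \<Rightarrow> nat \<Rightarrow> real" where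
  "scaled_moment A \<mu> m = \<mu> ^ m * (\<integral>x. x ^ m \<partial>A)"

end

theory Submission
  imports Defs
begin

text \<open>
  Let \<open>a\<close> be the law of the number of potential departures during an interarrival time, a
  mixture of Poisson laws, and let \<open>b\<close>, \<open>c\<close>, \<open>D\<close> be its successive tail sums.  Balancing the flow
  across each level shows that a stationary distribution is \<open>q (n - k) = q n * p k\<close>, where
  \<open>p = a + b * p\<close> (convolution) does not depend on \<open>n\<close>; hence the loss probability is
  \<open>1 / (\<Sum>k\<le>n. p k)\<close>.  If \<open>\<rho> = 1\<close>, then \<open>b\<close> has total mass \<open>1\<close>, and summing the
  convolution equation once gives \<open>(c * p) n = (\<Sum>k\<le>n. a k) \<le> 1\<close>, so \<open>p\<close> is bounded by
  \<open>1 / c 0\<close>.  Summing once more gives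
  \<open>m * (\<Sum>k\<le>n. p k) = (\<Sum>i\<le>n. \<Sum>k\<le>i. a k) + (D * p) n\<close> with \<open>m = \<rho>\<^sub>2 / 2\<close> the total mass of \<open>c\<close>.
  The right-hand side is \<open>n + O(1)\<close>, because \<open>D\<close> has total mass \<open>\<rho>\<^sub>3 / 6\<close>.
\<close>

section \<open>Iterated tails of the Poisson distribution\<close>

text \<open>
  \<open>ptail (Suc r) k\<close> is the tail \<open>\<Sum>i>k. ptail r i\<close>, the total mass of \<open>ptail r\<close> being \<open>y ^ r / fact r\<close>;
  subtracting a finite sum from the total avoids all infinite series.
\<close>

fun ptail :: "nat \<Rightarrow> nat \<Rightarrow> real \<Rightarrow> real" where
  "ptail 0 k y = y ^ k * exp (- y) / fact k"
| "ptail (Suc r) k y = y ^ r / fact r - (\<Sum>i\<le>k. ptail r i y)"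

lemma DERIV_power_over_fact:
  "((\<lambda>y::real. y ^ Suc j / fact (Suc j)) has_real_derivative y ^ j / fact j) (at y)"
  using DERIV_cdivide[OF DERIV_pow[of "Suc j" y UNIV], of "fact (Suc j)"]
  by (simp del: of_nat_Suc power_Suc)

text \<open>Differentiation lowers the level by one. The derivative of the \<open>i\<close>-th
  Poisson weight is the \<open>(i - 1)\<close>-st weight minus the \<open>i\<close>-th, so their sum
  telescopes; higher levels inherit the rule from the defining difference.\<close>

lemma DERIV_ptail: "(ptail (Suc r) k has_real_derivative ptail r k y) (at y)"
proof (induction r arbitrary: k)
  case 0
  have D: "((\<lambda>y. y ^ i * exp (- y) / fact i) has_real_derivative
      (if i = 0 then 0 else ptail 0 (i - 1) y) - ptail 0 i y) (at y)" for i :: nat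
  proof (cases i)
    case 0
    then show ?thesis by (auto intro!: derivative_eq_intros)
  next
    case (Suc j)
    have "((\<lambda>y. y ^ Suc j / fact (Suc j) * exp (- y)) has_real_derivative
        y ^ j / fact j * exp (- y) + - exp (- y) * (y ^ Suc j / fact (Suc j))) (at y)"
      by (rule DERIV_mult[OF DERIV_power_over_fact]) (auto intro!: derivative_eq_intros)
    then show ?thesis
      unfolding Suc by (simp add: ac_simps del: fact_Suc power_Suc)
  qed
  have "(\<Sum>i\<le>k. (if i = 0 then 0 else ptail 0 (i - 1) y) - ptail 0 i y) = - ptail 0 k y"
    by (induction k) auto
  moreover have "((\<lambda>y. y ^ 0 / fact 0 - (\<Sum>i\<le>k. ptail 0 i y)) has_real_derivative
      0 - (\<Sum>i\<le>k. (if i = 0 then 0 else ptail 0 (i - 1) y) - ptail 0 i y)) (at y)"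
    unfolding ptail.simps(1)
    by (intro DERIV_diff DERIV_sum D[unfolded ptail.simps(1)]) auto
  ultimately show ?case
    by (simp add: ptail.simps(2)[abs_def])
next
  case (Suc r)
  have "((\<lambda>y. y ^ Suc r / fact (Suc r) - (\<Sum>i\<le>k. ptail (Suc r) i y)) has_real_derivative
      y ^ r / fact r - (\<Sum>i\<le>k. ptail r i y)) (at y)"
    by (intro DERIV_diff DERIV_sum Suc DERIV_power_over_fact)
  then show ?case
    by (simp only: ptail.simps(2)[abs_def])
qed

lemma ptail_at_0: "ptail (Suc r) k 0 = 0"
proof (induction r arbitrary: k)
  case 0
  have "(\<Sum>i\<le>k. ptail 0 i 0) = 1"
    by (induction k) auto
  then show ?case by simp
qed simp

text \<open>A tail vanishes at 0, and its derivative, one level down, is nonnegative by induction.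
  Nonnegativity at level \<open>Suc r\<close> is at the same time a bound on the partial sums at
  level \<open>r\<close>.\<close>

lemma ptail_nonneg: "0 \<le> y \<Longrightarrow> 0 \<le> ptail r k y"
proof (induction r arbitrary: y)
  case (Suc r)
  have "ptail (Suc r) k 0 \<le> ptail (Suc r) k y"
  proof (rule DERIV_nonneg_imp_nondecreasing[OF Suc.prems])
    show "\<exists>d. (ptail (Suc r) k has_real_derivative d) (at x) \<and> 0 \<le> d" if "0 \<le> x" for x
      using DERIV_ptail Suc.IH[OF that] by blast
  qed
  then show ?case
    by (simp only: ptail_at_0)
qed simp

lemma sum_ptail_le: "0 \<le> y \<Longrightarrow> (\<Sum>i\<le>k. ptail r i y) \<le> y ^ r / fact r"
  using ptail_nonneg[of y "Suc r" k] by simp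

lemma ptail_le:
  assumes "0 \<le> y" shows "ptail r k y \<le> y ^ r / fact r"
proof -
  have "ptail r k y \<le> (\<Sum>i\<le>k. ptail r i y)"
    using assms by (intro member_le_sum) (auto intro: ptail_nonneg)
  then show ?thesis
    using sum_ptail_le[OF assms, of r k] by simp
qed

lemma borel_measurable_ptail [measurable]: "ptail r k \<in> borel_measurable borel"
proof (induction r arbitrary: k)
  case 0
  show ?case by (simp add: ptail.simps(1)[abs_def])
next
  case (Suc r)
  note [measurable] = this
  show ?case by (simp add: ptail.simps(2)[abs_def])
qed

section \<open>The convolution equation of the weights\<close>

text \<open>This is the equation \<open>p = a + b * p\<close> solved for its top term: with
  \<open>b 0 = 1 - a 0\<close>, moving \<open>b 0 * p k\<close> to the left leaves
  \<open>a 0 * p k\<close>.\<close>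

fun balance_weight :: "(nat \<Rightarrow> real) \<Rightarrow> (nat \<Rightarrow> real) \<Rightarrow> nat \<Rightarrow> real" where
  "balance_weight a b k = (a k + (\<Sum>l<k. b (k - l) * balance_weight a b l)) / a 0"

declare balance_weight.simps [simp del]

text \<open>Summation acts on one factor only, so summing the equation for \<open>p\<close> replaces
  a tail sequence by its partial sums, that is, by a total mass minus the next tail.\<close>

lemma sum_convolution:
  fixes x p :: "nat \<Rightarrow> real"
  shows "(\<Sum>k\<le>n. \<Sum>l\<le>k. x (k - l) * p l) = (\<Sum>l\<le>n. (\<Sum>i\<le>n - l. x i) * p l)"
proof (induction n)
  case (Suc n)
  have "(\<Sum>l\<le>n. (\<Sum>i\<le>Suc n - l. x i) * p l)
      = (\<Sum>l\<le>n. (\<Sum>i\<le>n - l. x i) * p l) + (\<Sum>l\<le>n. x (Suc n - l) * p l)"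
    unfolding sum.distrib[symmetric]
    by (intro sum.cong) (auto simp: Suc_diff_le algebra_simps)
  with Suc show ?case by simp
qed simp

locale balance_weights =
  fixes a b :: "nat \<Rightarrow> real"
  assumes a_nonneg: "0 \<le> a k" and a0: "0 < a 0"
    and b_eq: "b k = 1 - (\<Sum>i\<le>k. a i)" and b_nonneg: "0 \<le> b k"
begin

abbreviation p :: "nat \<Rightarrow> real" where "p \<equiv> balance_weight a b"

lemma p_nonneg: "0 \<le> p k"
proof (induction k rule: less_induct)
  case (less k)
  then show ?case
    by (subst balance_weight.simps)
       (intro divide_nonneg_pos add_nonneg_nonneg sum_nonneg mult_nonneg_nonneg a_nonneg b_nonneg a0, auto)
qed

lemma p_0: "p 0 = 1"
  using a0 by (subst balance_weight.simps) simp

lemma p_eq: "p k = a k + (\<Sum>l\<le>k. b (k - l) * p l)"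
proof -
  have "a 0 * p k = a k + (\<Sum>l<k. b (k - l) * p l)"
    using a0 by (subst balance_weight.simps) simp
  moreover have "b 0 * p k = p k - a 0 * p k"
    by (simp add: b_eq left_diff_distrib)
  moreover have "(\<Sum>l\<le>k. b (k - l) * p l) = (\<Sum>l<k. b (k - l) * p l) + b 0 * p k"
    by (simp add: lessThan_Suc_atMost[symmetric])
  ultimately show ?thesis
    by simp
qed

text \<open>The recursion as a flow balance, \<open>p k\<close> being the weight of level
  \<open>n - k\<close>. The term for \<open>l = 0\<close> carries \<open>b k\<close> instead of
  \<open>b (Suc k)\<close> because an arrival at the full level is lost; \<open>a (Suc k)\<close>
  makes up the difference.\<close>

lemma p_Suc_balance: "a 0 * p (Suc k) = b k * p 0 + (\<Sum>l=1..k. b (Suc k - l) * p l)"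
proof -
  have "a 0 * p (Suc k) = a (Suc k) + (\<Sum>l<Suc k. b (Suc k - l) * p l)"
    using a0 by (subst balance_weight.simps) simp
  also have "(\<Sum>l<Suc k. b (Suc k - l) * p l) = b (Suc k) * p 0 + (\<Sum>l=1..k. b (Suc k - l) * p l)"
    unfolding lessThan_Suc_atMost atMost_atLeast0 by (subst sum.atLeast_Suc_atMost) auto
  also have "b (Suc k) = b k - a (Suc k)"
    by (simp add: b_eq)
  finally show ?thesis
    by (simp add: p_0)
qed

text \<open>To be used with \<open>r k = q (n - k)\<close>. As \<open>a 0 > 0\<close>, each equation
  determines \<open>r (Suc k)\<close> from the earlier values, so the solutions are the multiples of
  \<open>p\<close>.\<close>

lemma balance_iff:
  "(\<forall>k<n. a 0 * r (Suc k) = b k * r 0 + (\<Sum>l=1..k. b (Suc k - l) * r l))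
    \<longleftrightarrow> (\<forall>k\<le>n. r k = r 0 * p k)"
proof
  assume bal: "\<forall>k<n. a 0 * r (Suc k) = b k * r 0 + (\<Sum>l=1..k. b (Suc k - l) * r l)"
  have "r k = r 0 * p k" if "k \<le> n" for k
    using that
  proof (induction k rule: less_induct)
    case (less k)
    show ?case
    proof (cases k)
      case 0
      then show ?thesis by (simp add: p_0)
    next
      case (Suc j)
      have "(\<Sum>l=1..j. b (Suc j - l) * r l) = (\<Sum>l=1..j. b (Suc j - l) * (r 0 * p l))"
        using less.prems by (intro sum.cong refl arg_cong2[where f = "(*)"] less.IH) (auto simp: Suc)
      moreover have "a 0 * r (Suc j) = b j * r 0 + (\<Sum>l=1..j. b (Suc j - l) * r l)"
        using bal less.prems Suc by simp
      ultimately have "a 0 * r (Suc j) = r 0 * (a 0 * p (Suc j))"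
        unfolding p_Suc_balance by (simp add: p_0 sum_distrib_left algebra_simps)
      with a0 show ?thesis
        by (simp add: Suc)
    qed
  qed
  then show "\<forall>k\<le>n. r k = r 0 * p k" by blast
next
  assume r: "\<forall>k\<le>n. r k = r 0 * p k"
  show "\<forall>k<n. a 0 * r (Suc k) = b k * r 0 + (\<Sum>l=1..k. b (Suc k - l) * r l)"
  proof (intro allI impI)
    fix k assume k: "k < n"
    have "(\<Sum>l=1..k. b (Suc k - l) * r l) = (\<Sum>l=1..k. b (Suc k - l) * (r 0 * p l))"
      using k by (intro sum.cong refl arg_cong2[where f = "(*)"] r[rule_format]) auto
    moreover have "r (Suc k) = r 0 * p (Suc k)"
      using k by (intro r[rule_format]) simp
    ultimately have "a 0 * r (Suc k) = r 0 * (a 0 * p (Suc k))"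
        "b k * r 0 + (\<Sum>l=1..k. b (Suc k - l) * r l) = r 0 * (b k * p 0 + (\<Sum>l=1..k. b (Suc k - l) * p l))"
      by (simp_all add: p_0 sum_distrib_left algebra_simps)
    then show "a 0 * r (Suc k) = b k * r 0 + (\<Sum>l=1..k. b (Suc k - l) * r l)"
      by (simp only: p_Suc_balance)
  qed
qed

end

section \<open>The critical case: growth of the partial sums of the weights\<close>

locale critical_weights = balance_weights +
  fixes c D :: "nat \<Rightarrow> real" and m M :: real
  assumes c_eq: "c k = 1 - (\<Sum>i\<le>k. b i)" and c_nonneg: "0 \<le> c k"
    and D_eq: "D k = m - (\<Sum>i\<le>k. c i)" and D_nonneg: "0 \<le> D k"
    and sum_D_le: "(\<Sum>i\<le>k. D i) \<le> M"
begin

text \<open>In the summed equation for \<open>p\<close>, the partial sums of \<open>b\<close> are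
  \<open>1 - c\<close>, so the sum of \<open>p\<close> cancels. The 1 in \<open>c_eq\<close> is
  where criticality enters.\<close>

lemma sum_p_c: "(\<Sum>l\<le>n. c (n - l) * p l) = (\<Sum>k\<le>n. a k)"
proof -
  have "(\<Sum>k\<le>n. p k) = (\<Sum>k\<le>n. a k) + (\<Sum>k\<le>n. \<Sum>l\<le>k. b (k - l) * p l)"
    unfolding sum.distrib[symmetric] by (intro sum.cong p_eq refl)
  then show ?thesis
    unfolding sum_convolution by (simp add: c_eq left_diff_distrib sum_subtractf)
qed

lemma c_0: "c 0 = a 0"
  by (simp add: c_eq b_eq)

lemma p_le: "p n \<le> 1 / a 0"
proof -
  have "c (n - n) * p n \<le> (\<Sum>l\<le>n. c (n - l) * p l)"
    by (rule member_le_sum) (auto simp: c_nonneg p_nonneg)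
  also have "\<dots> \<le> 1"
    using b_nonneg[of n] by (simp add: sum_p_c b_eq)
  finally show ?thesis
    using a0 by (simp add: c_0 field_simps)
qed

lemma sum_p_m:
  "m * (\<Sum>l\<le>n. p l) = (real n + 1 - (\<Sum>k\<le>n. b k)) + (\<Sum>l\<le>n. D (n - l) * p l)"
proof -
  have "(\<Sum>l\<le>n. (m - D (n - l)) * p l) = (\<Sum>k\<le>n. \<Sum>l\<le>k. c (k - l) * p l)"
    unfolding sum_convolution by (simp add: D_eq)
  also have "\<dots> = (\<Sum>k\<le>n. 1 - b k)"
    by (simp add: sum_p_c b_eq)
  finally show ?thesis
    by (simp add: sum_subtractf left_diff_distrib sum_distrib_left)
qed

lemma sum_p_ge: "real n \<le> m * (\<Sum>l\<le>n. p l)"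
proof -
  have "0 \<le> (\<Sum>l\<le>n. D (n - l) * p l)"
    by (intro sum_nonneg mult_nonneg_nonneg D_nonneg p_nonneg)
  then show ?thesis
    using c_nonneg[of n] by (simp add: sum_p_m c_eq)
qed

lemma sum_p_upper: "m * (\<Sum>l\<le>n. p l) \<le> real n + (1 + M / a 0)"
proof -
  have "(\<Sum>l\<le>n. D (n - l) * p l) \<le> (\<Sum>l\<le>n. D (n - l) * (1 / a 0))"
    by (intro sum_mono mult_left_mono p_le D_nonneg)
  also have "\<dots> = (\<Sum>l\<le>n. D l) / a 0"
    by (subst sum.nat_diff_reindex[where n = "Suc n" and g = D, unfolded lessThan_Suc_atMost diff_Suc_Suc, symmetric])
       (simp add: sum_divide_distrib)
  also have "\<dots> \<le> M / a 0"
    using a0 sum_D_le by (simp add: divide_right_mono)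
  finally show ?thesis
    using sum_nonneg[of "{..n}" b] by (simp add: sum_p_m b_nonneg)
qed

lemma inverse_sum_p_bigo:
  "(\<lambda>n. 1 / (\<Sum>l\<le>n. p l) - m / real n) \<in> O(\<lambda>n. 1 / (real n)\<^sup>2)"
proof -
  define K where "K = 1 + M / a 0"
  \<comment> \<open>From \<open>D 0 = m - c 0 \<ge> 0\<close> and
    \<open>c 0 = a 0 > 0\<close>.\<close>
  have m0: "0 < m"
    using D_nonneg[of 0] a0 by (simp add: D_eq c_0)
  have "\<bar>1 / (\<Sum>l\<le>n. p l) - m / real n\<bar> \<le> m * K * \<bar>1 / (real n)\<^sup>2\<bar>" if n: "1 \<le> n" for n
  proof -
    \<comment> \<open>\<open>T\<close> lies between \<open>n\<close> and \<open>n + K\<close>, so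
      \<open>m / T\<close> and \<open>m / n\<close> differ by at most
      \<open>m * K / n^2\<close>.\<close>
    define T where "T = m * (\<Sum>l\<le>n. p l)"
    have T: "real n \<le> T" "T \<le> real n + K"
      using sum_p_ge[of n] sum_p_upper[of n] by (auto simp: T_def K_def)
    have "1 / (\<Sum>l\<le>n. p l) = m / T"
      using m0 by (simp add: T_def)
    moreover have "m / T - m / real n = - (m * ((T - n) / (T * n)))"
      using n T by (simp add: field_simps)
    ultimately have eq: "1 / (\<Sum>l\<le>n. p l) - m / real n = - (m * ((T - n) / (T * n)))"
      by simp
    have "(T - n) / (T * n) \<le> K / (real n * real n)"
      using T n by (intro frac_le mult_mono) auto
    moreover have "0 \<le> (T - n) / (T * n)"
      using T n by simp
    ultimately have "m * \<bar>(T - n) / (T * n)\<bar> \<le> m * (K / (real n * real n))"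
      using m0 by (intro mult_left_mono) auto
    then show ?thesis
      unfolding eq using m0 by (simp add: abs_mult power2_eq_square)
  qed
  then have "\<forall>\<^sub>F n in sequentially. norm (1 / (\<Sum>l\<le>n. p l) - m / real n)
      \<le> m * K * norm (1 / (real n)\<^sup>2)"
    unfolding real_norm_def by (rule eventually_sequentiallyI)
  then show ?thesis
    by (rule bigoI)
qed

end

section \<open>Transition probabilities\<close>

abbreviation service_law :: "real \<Rightarrow> (nat \<Rightarrow> real) measure" where
  "service_law \<mu> \<equiv> (\<Pi>\<^sub>M i\<in>(UNIV :: nat set). density lborel (\<lambda>x. ennreal (exponential_density \<mu> x)))"

lemma prob_space_service_law: "0 < \<mu> \<Longrightarrow> prob_space (service_law \<mu>)"
  by (intro prob_space_PiM prob_space_exponential_density)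

lemma measurable_service_component [measurable]: "(\<lambda>s. s i) \<in> borel_measurable (service_law \<mu>)"
  using measurable_component_singleton[of i UNIV "\<lambda>_. density lborel (\<lambda>x. ennreal (exponential_density \<mu> x))"]
  by simp

lemma distr_service_component:
  assumes "0 < \<mu>"
  shows "distr (service_law \<mu>) borel (\<lambda>s. s i) = density lborel (\<lambda>x. ennreal (exponential_density \<mu> x))"
proof -
  have "distr (service_law \<mu>) borel (\<lambda>s. s i)
      = distr (service_law \<mu>) (density lborel (\<lambda>x. ennreal (exponential_density \<mu> x))) (\<lambda>s. s i)"
    by (intro distr_cong) auto
  then show ?thesis
    using distr_PiM_component[of UNIV "\<lambda>_. density lborel (\<lambda>x. ennreal (exponential_density \<mu> x))" i]
      prob_space_exponential_density[OF assms] by simp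
qed

lemma distributed_service_component:
  assumes "0 < \<mu>"
  shows "distributed (service_law \<mu>) lborel (\<lambda>s. s i) (exponential_density \<mu>)"
proof -
  have "distr (service_law \<mu>) lborel (\<lambda>s. s i) = distr (service_law \<mu>) borel (\<lambda>s. s i)"
    by (intro distr_cong) auto
  then show ?thesis
    using distr_service_component[OF assms] by (simp add: distributed_def)
qed

lemma indep_vars_service:
  assumes "0 < \<mu>"
  shows "prob_space.indep_vars (service_law \<mu>) (\<lambda>_. borel) (\<lambda>i s. s i) UNIV"
proof -
  interpret prob_space "service_law \<mu>"
    by (rule prob_space_service_law[OF assms])
  have "distr (service_law \<mu>) (\<Pi>\<^sub>M i\<in>UNIV. borel) (\<lambda>s. s) = distr (service_law \<mu>) (service_law \<mu>) (\<lambda>s. s)"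
    by (intro distr_cong sets_PiM_cong) auto
  then show ?thesis
    by (subst indep_vars_iff_distr_eq_PiM') (auto simp: distr_service_component assms restrict_UNIV)
qed

text \<open>The \<open>d\<close>-th departure is later than \<open>t\<close> iff fewer than
  \<open>d\<close> Poisson events occur up to \<open>t\<close>. The index \<open>d - 1\<close>
  appears since \<open>erlang_density k\<close> belongs to a sum of \<open>k + 1\<close>
  exponentials.\<close>

lemma prob_service_sum_gt:
  assumes "0 < \<mu>" "0 \<le> t" "0 < d"
  shows "measure (service_law \<mu>) {s \<in> space (service_law \<mu>). t < (\<Sum>i<d. s i)} = (\<Sum>k<d. ptail 0 k (\<mu> * t))"
proof -
  interpret prob_space "service_law \<mu>"
    by (rule prob_space_service_law[OF assms(1)])
  have "distributed (service_law \<mu>) lborel (\<lambda>s. \<Sum>i<d. s i) (erlang_density (card {..<d} - 1) \<mu>)"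
    using assms
    by (intro exponential_distributed_sum distributed_service_component indep_vars_subset[OF indep_vars_service]) auto
  then have "measure (service_law \<mu>) {s \<in> space (service_law \<mu>). t < (\<Sum>i<d. s i)} = 1 - erlang_CDF (d - 1) \<mu> t"
    using erlang_distributed_gt[of "\<lambda>s. \<Sum>i<d. s i" "d - 1" \<mu> t] assms by simp
  also have "\<dots> = (\<Sum>k\<le>d - 1. ptail 0 k (\<mu> * t))"
    using assms by (simp add: erlang_CDF_def)
  also have "{..d - 1} = {..<d}"
    using assms by auto
  finally show ?thesis .
qed

lemma AE_service_nonneg:
  assumes "0 < \<mu>"
  shows "AE s in service_law \<mu>. \<forall>i. 0 \<le> s i"
proof -
  have "AE x in density lborel (\<lambda>x. ennreal (exponential_density \<mu> x)). 0 \<le> x"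
    by (subst AE_density) (auto simp: exponential_density_def)
  then show ?thesis
    unfolding AE_all_countable
    by (intro allI AE_PiM_component prob_space_exponential_density assms) auto
qed

text \<open>Departure epochs are nondecreasing, so the departures up to \<open>t\<close> form an
  initial segment of \<open>{1..m}\<close>, and \<open>J\<close> customers remain iff departure
  number \<open>m - J + 1\<close> is still to come.\<close>

lemma remaining_ge_iff:
  assumes s: "\<And>i. 0 \<le> s i" and J: "1 \<le> J" "J \<le> m"
  shows "J \<le> remaining m t s \<longleftrightarrow> t < (\<Sum>i<Suc (m - J). s i)"
proof -
  define E where "E = {d \<in> {1..m}. (\<Sum>i<d. s i) \<le> t}"
  have mono: "(\<Sum>i<d. s i) \<le> (\<Sum>i<d'. s i)" if "d \<le> d'" for d d'
    using that s by (intro sum_mono2) auto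
  have sub: "E \<subseteq> {1..m}"
    by (auto simp: E_def)
  have "finite E" "card E \<le> m"
    using finite_subset[OF sub] card_mono[OF _ sub] by auto
  then have "J \<le> remaining m t s \<longleftrightarrow> card E \<le> m - J"
    using J unfolding remaining_def E_def[symmetric] by auto
  also have "\<dots> \<longleftrightarrow> t < (\<Sum>i<Suc (m - J). s i)"
  proof
    assume card: "card E \<le> m - J"
    show "t < (\<Sum>i<Suc (m - J). s i)"
    proof (rule ccontr)
      assume "\<not> t < (\<Sum>i<Suc (m - J). s i)"
      then have "{1..Suc (m - J)} \<subseteq> E"
        using J mono[of _ "Suc (m - J)"] by (force simp: E_def)
      from card_mono[OF \<open>finite E\<close> this] card show False
        by simp
    qed
  next
    assume "t < (\<Sum>i<Suc (m - J). s i)"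
    then have "d \<le> m - J" if "d \<in> E" for d
      using that mono[of "Suc (m - J)" d] by (force simp: E_def not_less_eq_eq)
    then have "E \<subseteq> {1..m - J}"
      by (auto simp: E_def)
    from card_mono[OF _ this] show "card E \<le> m - J"
      by simp
  qed
  finally show ?thesis .
qed

lemma remaining_le: "remaining m t s \<le> m"
  by (simp add: remaining_def)

section \<open>Averaging over the interarrival time\<close>

locale interarrival = real_distribution A for A :: "real measure" +
  fixes \<mu> :: real
  assumes nonneg: "AE x in A. 0 \<le> x" and rate_pos: "0 < \<mu>"
begin

lemma AE_scaled_nonneg: "AE x in A. 0 \<le> \<mu> * x"
  using nonneg by eventually_elim (simp add: rate_pos less_imp_le)

lemma prob_space_step_law: "prob_space (step_law A \<mu>)"
proof -
  interpret S: prob_space "service_law \<mu>"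
    by (rule prob_space_service_law[OF rate_pos])
  interpret P: pair_prob_space A "service_law \<mu>" ..
  show ?thesis
    unfolding step_law_def by (rule P.P.prob_space_axioms)
qed

lemma measurable_remaining [measurable]:
  "(\<lambda>\<omega>. remaining m (fst \<omega>) (snd \<omega>)) \<in> measurable (step_law A \<mu>) (count_space UNIV)"
proof -
  have "remaining m t s = m - (\<Sum>d=1..m. if (\<Sum>i<d. s i) \<le> t then 1 else 0)" for t s
    by (simp add: remaining_def sum.If_cases Collect_conj_eq[symmetric] Int_def conj_commute)
  then show ?thesis
    unfolding step_law_def by simp
qed

text \<open>Level 0 is the law \<open>a\<close> of the number of potential departures; levels 1, 2
  and 3 are its iterated tails \<open>b\<close>, \<open>c\<close> and \<open>D\<close>.\<close>

definition mean_ptail :: "nat \<Rightarrow> nat \<Rightarrow> real" where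
  "mean_ptail r k = (\<integral>x. ptail r k (\<mu> * x) \<partial>A)"

lemma integrable_ptail:
  assumes "integrable A (\<lambda>x. x ^ r)"
  shows "integrable A (\<lambda>x. ptail r k (\<mu> * x))"
proof (rule Bochner_Integration.integrable_bound)
  show "integrable A (\<lambda>x. \<mu> ^ r * x ^ r / fact r)"
    using assms by simp
  show "AE x in A. norm (ptail r k (\<mu> * x)) \<le> norm (\<mu> ^ r * x ^ r / fact r)"
    using AE_scaled_nonneg
  proof eventually_elim
    case (elim x)
    then show ?case
      using ptail_nonneg[OF elim, of r k] ptail_le[OF elim, of r k]
      by (simp only: real_norm_def power_mult_distrib)
  qed
qed simp

lemma mean_ptail_Suc:
  assumes "integrable A (\<lambda>x. x ^ r)"
  shows "mean_ptail (Suc r) k = (\<integral>x. (\<mu> * x) ^ r / fact r \<partial>A) - (\<Sum>i\<le>k. mean_ptail r i)"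
  using assms by (simp add: mean_ptail_def integrable_ptail power_mult_distrib)

lemma mean_ptail_nonneg: "0 \<le> mean_ptail r k"
  unfolding mean_ptail_def using AE_scaled_nonneg
  by (intro integral_nonneg_AE) (auto intro: ptail_nonneg elim!: eventually_mono)

lemma mean_ptail_0_pos: "0 < mean_ptail 0 0"
proof -
  have int: "integrable A (\<lambda>x. exp (- (\<mu> * x)))"
    using integrable_ptail[of 0 0] by simp
  have "mean_ptail 0 0 \<noteq> 0"
    using integral_nonneg_eq_0_iff_AE[OF int] AE_False by (simp add: mean_ptail_def)
  with mean_ptail_nonneg[of 0 0] show ?thesis
    by linarith
qed

lemma sum_mean_ptail_le:
  assumes "integrable A (\<lambda>x. x ^ r)"
  shows "(\<Sum>i\<le>k. mean_ptail r i) \<le> (\<integral>x. (\<mu> * x) ^ r / fact r \<partial>A)"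
  using mean_ptail_Suc[OF assms, of k] mean_ptail_nonneg[of "Suc r" k] by simp

lemma prob_remaining_ge:
  assumes J: "1 \<le> J" "J \<le> m"
  shows "measure (step_law A \<mu>) {\<omega> \<in> space (step_law A \<mu>). J \<le> remaining m (fst \<omega>) (snd \<omega>)}
    = (\<Sum>k\<le>m - J. mean_ptail 0 k)"
proof -
  let ?X = "{\<omega> \<in> space (step_law A \<mu>). J \<le> remaining m (fst \<omega>) (snd \<omega>)}"
  interpret S: prob_space "service_law \<mu>"
    by (rule prob_space_service_law[OF rate_pos])
  interpret step: prob_space "step_law A \<mu>"
    by (rule prob_space_step_law)
  have X: "?X \<in> sets (step_law A \<mu>)"
    by measurable
  \<comment> \<open>For a fixed interarrival time \<open>t\<close>, the event says that departure
    \<open>Suc (m - J)\<close> falls after \<open>t\<close>, up to the null set where some service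
    time is negative. Fubini then averages over \<open>t\<close>.\<close>
  have inner: "emeasure (service_law \<mu>) (Pair t -` ?X) = ennreal (\<Sum>k\<le>m - J. ptail 0 k (\<mu> * t))"
    if t: "0 \<le> t" for t
  proof -
    have "Pair t -` ?X \<in> sets (service_law \<mu>)"
      using X unfolding step_law_def by (rule sets_Pair1)
    moreover have "AE s in service_law \<mu>. s \<in> Pair t -` ?X
        \<longleftrightarrow> s \<in> {s \<in> space (service_law \<mu>). t < (\<Sum>i<Suc (m - J). s i)}"
      using AE_service_nonneg[OF rate_pos] AE_space
    proof eventually_elim
      case (elim s)
      then show ?case
        using remaining_ge_iff[OF _ J, of s t] by (simp add: step_law_def space_pair_measure)
    qed
    ultimately have "emeasure (service_law \<mu>) (Pair t -` ?X)
        = emeasure (service_law \<mu>) {s \<in> space (service_law \<mu>). t < (\<Sum>i<Suc (m - J). s i)}"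
      by (intro emeasure_eq_AE) (simp_all del: sum.lessThan_Suc)
    then show ?thesis
      using prob_service_sum_gt[OF rate_pos t, of "Suc (m - J)"]
      by (simp add: S.emeasure_eq_measure lessThan_Suc_atMost del: sum.lessThan_Suc)
  qed
  have "emeasure (step_law A \<mu>) ?X = (\<integral>\<^sup>+t. emeasure (service_law \<mu>) (Pair t -` ?X) \<partial>A)"
    using X unfolding step_law_def by (rule S.emeasure_pair_measure_alt)
  also have "\<dots> = (\<integral>\<^sup>+t. ennreal (\<Sum>k\<le>m - J. ptail 0 k (\<mu> * t)) \<partial>A)"
    by (intro nn_integral_cong_AE eventually_mono[OF nonneg] inner)
  also have "\<dots> = ennreal (\<integral>t. (\<Sum>k\<le>m - J. ptail 0 k (\<mu> * t)) \<partial>A)"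
    using AE_scaled_nonneg
    by (intro nn_integral_eq_integral Bochner_Integration.integrable_sum integrable_ptail)
       (auto intro!: sum_nonneg ptail_nonneg elim!: eventually_mono simp del: ptail.simps)
  also have "(\<integral>t. (\<Sum>k\<le>m - J. ptail 0 k (\<mu> * t)) \<partial>A) = (\<Sum>k\<le>m - J. mean_ptail 0 k)"
    unfolding mean_ptail_def by (intro Bochner_Integration.integral_sum integrable_ptail) simp
  finally show ?thesis
    by (simp add: step.emeasure_eq_measure sum_nonneg mean_ptail_nonneg)
qed

text \<open>Tails of a transition row are plain partial sums of \<open>a\<close>, unlike its entry
  at 0. The case \<open>J = 0\<close> is separate because the empty system collects all the
  remaining mass.\<close>

lemma sum_trans_prob:
  assumes "J \<le> n"
  shows "(\<Sum>j=J..n. trans_prob A \<mu> n i j)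
    = (if J = 0 then 1 else if J \<le> Suc i then \<Sum>k\<le>min (Suc i) n - J. mean_ptail 0 k else 0)"
proof -
  interpret step: prob_space "step_law A \<mu>"
    by (rule prob_space_step_law)
  let ?R = "\<lambda>\<omega>. remaining (min (i + 1) n) (fst \<omega>) (snd \<omega>)"
  have le: "?R \<omega> \<le> min (Suc i) n" for \<omega>
    using remaining_le[of "min (i + 1) n" "fst \<omega>" "snd \<omega>"] by simp
  have "(\<Sum>j=J..n. trans_prob A \<mu> n i j)
      = measure (step_law A \<mu>) (\<Union>j\<in>{J..n}. {\<omega> \<in> space (step_law A \<mu>). ?R \<omega> = j})"
    unfolding trans_prob_def
    by (intro step.finite_measure_finite_Union[symmetric]) (auto simp: disjoint_family_on_def)
  also have "(\<Union>j\<in>{J..n}. {\<omega> \<in> space (step_law A \<mu>). ?R \<omega> = j}) = {\<omega> \<in> space (step_law A \<mu>). J \<le> ?R \<omega>}"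
    using le by auto
  finally have *: "(\<Sum>j=J..n. trans_prob A \<mu> n i j)
      = measure (step_law A \<mu>) {\<omega> \<in> space (step_law A \<mu>). J \<le> ?R \<omega>}" .
  consider "J = 0" | "1 \<le> J" "J \<le> min (i + 1) n" | "min (i + 1) n < J"
    by linarith
  then show ?thesis
  proof cases
    case 1
    then show ?thesis unfolding * by (simp add: step.prob_space)
  next
    case 2
    then show ?thesis unfolding * by (subst prob_remaining_ge) auto
  next
    case 3
    then have "\<not> J \<le> ?R \<omega>" for \<omega>
      using le[of \<omega>] by linarith
    then have "{\<omega> \<in> space (step_law A \<mu>). J \<le> ?R \<omega>} = {}"
      by blast
    then show ?thesis unfolding * using 3 assms by (simp only: measure_empty) auto
  qed
qed

end

section \<open>Stationary distribution and loss probability\<close>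

context interarrival
begin

sublocale balance_weights "mean_ptail 0" "mean_ptail (Suc 0)"
proof
  show "mean_ptail (Suc 0) k = 1 - (\<Sum>i\<le>k. mean_ptail 0 i)" for k
    using mean_ptail_Suc[of 0 k] by (simp add: prob_space[unfolded space_eq_univ])
qed (rule mean_ptail_nonneg mean_ptail_0_pos)+

text \<open>Two vectors on \<open>{0..n}\<close> agree iff their tails do, and tails are what
  \<open>sum_trans_prob\<close> evaluates.\<close>

lemma stationary_iff_tails:
  "stationary A \<mu> n q \<longleftrightarrow> (\<forall>i\<le>n. 0 \<le> q i) \<and> (\<Sum>i\<le>n. q i) = 1 \<and>
     (\<forall>J\<le>n. (\<Sum>j=J..n. q j) = (\<Sum>i\<le>n. q i * (\<Sum>j=J..n. trans_prob A \<mu> n i j)))"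
proof -
  define v where "v j = (\<Sum>i\<le>n. q i * trans_prob A \<mu> n i j)" for j
  have swap: "(\<Sum>i\<le>n. q i * (\<Sum>j=J..n. trans_prob A \<mu> n i j)) = (\<Sum>j=J..n. v j)" for J
    unfolding v_def sum_distrib_left by (rule sum.swap)
  have "(\<forall>j\<le>n. q j = v j) \<longleftrightarrow> (\<forall>J\<le>n. (\<Sum>j=J..n. q j) = (\<Sum>j=J..n. v j))"
  proof
    assume tails: "\<forall>J\<le>n. (\<Sum>j=J..n. q j) = (\<Sum>j=J..n. v j)"
    then have "(\<Sum>j=Suc J..n. q j) = (\<Sum>j=Suc J..n. v j)" for J
      by (cases "Suc J \<le> n") auto
    with tails show "\<forall>j\<le>n. q j = v j"
      by (auto simp: sum.atLeast_Suc_atMost)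
  qed auto
  then show ?thesis
    unfolding swap by (simp add: stationary_def v_def)
qed

text \<open>The equation for the tail from level \<open>n - k\<close> says that the last two terms cancel.\<close>

lemma tail_balance:
  assumes k: "k < n"
  shows "(\<Sum>i\<le>n. q i * (\<Sum>j=n - k..n. trans_prob A \<mu> n i j))
    = (\<Sum>j=n - k..n. q j) - (mean_ptail (Suc 0) k * q n + (\<Sum>l=1..k. mean_ptail (Suc 0) (Suc k - l) * q (n - l)))
      + mean_ptail 0 0 * q (n - Suc k)"
proof -
  define G where "G j = (\<Sum>i\<le>j. mean_ptail 0 i)" for j
  have G: "G j = 1 - mean_ptail (Suc 0) j" for j
    by (simp add: G_def b_eq)
  define t where "t i = q i * (if n - k \<le> Suc i then G (min (Suc i) n - (n - k)) else 0)" for i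
  have "(\<Sum>i\<le>n. q i * (\<Sum>j=n - k..n. trans_prob A \<mu> n i j)) = (\<Sum>i\<le>n. t i)"
    using k by (intro sum.cong) (auto simp: sum_trans_prob t_def G_def)
  also have "\<dots> = (\<Sum>l\<le>n. t (n - l))"
    by (rule sum.reindex_bij_witness[of _ "\<lambda>l. n - l" "\<lambda>l. n - l"]) auto
  \<comment> \<open>One step raises the level by at most one, so level \<open>n - k\<close> is
    reached only from \<open>n - Suc k\<close> upwards.\<close>
  also have "\<dots> = (\<Sum>l\<le>Suc k. t (n - l))"
    using k by (intro sum.mono_neutral_right) (auto simp: t_def)
  also have "\<dots> = t n + (\<Sum>l=1..k. t (n - l)) + t (n - Suc k)"
    unfolding atMost_atLeast0 by (subst sum.atLeast_Suc_atMost) auto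
  also have "(\<Sum>l=1..k. t (n - l)) = (\<Sum>l=1..k. q (n - l) - mean_ptail (Suc 0) (Suc k - l) * q (n - l))"
  proof (intro sum.cong refl)
    fix l assume l: "l \<in> {1..k}"
    have "min (Suc (n - l)) n - (n - k) = Suc k - l" "n - k \<le> Suc (n - l)"
      using k l by auto
    then show "t (n - l) = q (n - l) - mean_ptail (Suc 0) (Suc k - l) * q (n - l)"
      by (simp add: t_def G algebra_simps)
  qed
  \<comment> \<open>At the full level the \<open>min\<close> yields the argument \<open>k\<close>,
    not \<open>Suc k\<close>: the arrival is lost.\<close>
  also have "t n = q n - mean_ptail (Suc 0) k * q n"
    using k by (simp add: t_def G algebra_simps)
  also have "t (n - Suc k) = mean_ptail 0 0 * q (n - Suc k)"
    using k by (simp add: t_def G_def Suc_diff_Suc)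
  finally have "(\<Sum>i\<le>n. q i * (\<Sum>j=n - k..n. trans_prob A \<mu> n i j)) =
      (q n + (\<Sum>l=1..k. q (n - l)))
      - (mean_ptail (Suc 0) k * q n + (\<Sum>l=1..k. mean_ptail (Suc 0) (Suc k - l) * q (n - l)))
      + mean_ptail 0 0 * q (n - Suc k)"
    by (simp add: sum_subtractf)
  moreover have "(\<Sum>j=n - k..n. q j) = (\<Sum>l=0..k. q (n - l))"
    using k by (intro sum.reindex_bij_witness[of _ "\<lambda>l. n - l" "\<lambda>l. n - l"]) auto
  moreover have "\<dots> = q n + (\<Sum>l=1..k. q (n - l))"
    by (subst sum.atLeast_Suc_atMost) auto
  ultimately show ?thesis
    by simp
qed

lemma stationary_iff:
  "stationary A \<mu> n q \<longleftrightarrow> (\<forall>i\<le>n. 0 \<le> q i) \<and> (\<Sum>i\<le>n. q i) = 1 \<and> (\<forall>k\<le>n. q (n - k) = q n * p k)"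
proof -
  define E where "E J \<longleftrightarrow> (\<Sum>j=J..n. q j) = (\<Sum>i\<le>n. q i * (\<Sum>j=J..n. trans_prob A \<mu> n i j))" for J
  \<comment> \<open>Level 0 is automatic, every row having sum 1. The remaining levels are
    \<open>n - k\<close> with \<open>k < n\<close>.\<close>
  have "(\<Sum>j=0..n. q j) = (\<Sum>i\<le>n. q i * (\<Sum>j=0..n. trans_prob A \<mu> n i j))"
    by (subst sum_trans_prob) (auto simp: atMost_atLeast0)
  then have "E 0"
    by (simp add: E_def)
  then have "(\<forall>J\<le>n. E J) \<longleftrightarrow> (\<forall>k<n. E (n - k))"
    by (metis diff_diff_cancel diff_le_self diff_less le_neq_implies_less not_gr_zero order_less_le_trans zero_less_diff)
  also have "\<dots> \<longleftrightarrow> (\<forall>k<n. mean_ptail 0 0 * q (n - Suc k)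
      = mean_ptail (Suc 0) k * q (n - 0) + (\<Sum>l=1..k. mean_ptail (Suc 0) (Suc k - l) * q (n - l)))"
    by (intro all_cong) (auto simp: E_def tail_balance)
  also have "\<dots> \<longleftrightarrow> (\<forall>k\<le>n. q (n - k) = q n * p k)"
    using balance_iff[of n "\<lambda>k. q (n - k)"] by simp
  finally show ?thesis
    by (simp add: stationary_iff_tails E_def)
qed

text \<open>Normalisation fixes \<open>q n\<close> in \<open>q (n - k) = q n * p k\<close>, which
  gives uniqueness; the reversed and normalised weights give existence. Together they evaluate the
  \<open>THE\<close>.\<close>

lemma loss_prob_eq: "loss_prob A \<mu> n = 1 / (\<Sum>k\<le>n. p k)"
proof -
  have rev: "(\<Sum>i\<le>n. q i) = (\<Sum>k\<le>n. q (n - k))" for q :: "nat \<Rightarrow> real"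
    by (rule sum.reindex_bij_witness[of _ "\<lambda>l. n - l" "\<lambda>l. n - l"]) auto
  have "p 0 \<le> (\<Sum>k\<le>n. p k)"
    by (intro member_le_sum) (auto simp: p_nonneg)
  then have pos: "0 < (\<Sum>k\<le>n. p k)"
    by (simp add: p_0)
  define q where "q i = p (n - i) / (\<Sum>k\<le>n. p k)" for i
  have "stationary A \<mu> n q"
    unfolding stationary_iff
  proof (intro conjI allI impI)
    show "(\<Sum>i\<le>n. q i) = 1"
      using pos by (subst rev) (simp add: q_def sum_divide_distrib[symmetric])
  qed (use pos in \<open>auto simp: q_def p_0 p_nonneg\<close>)
  moreover have "q n = 1 / (\<Sum>k\<le>n. p k)"
    by (simp add: q_def p_0)
  moreover have "r n = 1 / (\<Sum>k\<le>n. p k)" if "stationary A \<mu> n r" for r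
  proof -
    have "(\<Sum>k\<le>n. r n * p k) = (\<Sum>k\<le>n. r (n - k))"
      using that by (intro sum.cong) (auto simp: stationary_iff)
    also have "\<dots> = (\<Sum>k\<le>n. r k)"
      by (rule rev[symmetric])
    also have "\<dots> = 1"
      using that by (simp add: stationary_iff)
    finally show ?thesis
      using pos by (simp add: sum_distrib_left[symmetric] field_simps)
  qed
  ultimately show ?thesis
    unfolding loss_prob_def by (intro the_equality) (metis, metis)
qed

lemma loss_prob_critical_bigo:
  assumes int1: "integrable A (\<lambda>x. x)" and int3: "integrable A (\<lambda>x. x ^ 3)"
    and mean: "\<mu> * (\<integral>x. x \<partial>A) = 1"
  shows "(\<lambda>n. loss_prob A \<mu> n - scaled_moment A \<mu> 2 / (2 * real n)) \<in> O(\<lambda>n. 1 / (real n)\<^sup>2)"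
proof -
  \<comment> \<open>Domination, since \<open>x + x^3 - x^2 = x * ((x - 1)^2 + x) \<ge> 0\<close> for
    \<open>x \<ge> 0\<close>.\<close>
  have int2: "integrable A (\<lambda>x. x ^ 2)"
  proof (rule Bochner_Integration.integrable_bound)
    show "integrable A (\<lambda>x. x + x ^ 3)"
      using int1 int3 by simp
    have "x ^ 2 \<le> x + x ^ 3" if "0 \<le> x" for x :: real
    proof -
      have "0 \<le> x * ((x - 1)\<^sup>2 + x)"
        using that by simp
      then show ?thesis
        by (simp add: power2_eq_square power3_eq_cube algebra_simps)
    qed
    then show "AE x in A. norm (x ^ 2) \<le> norm (x + x ^ 3)"
      using nonneg by (auto elim!: eventually_mono)
  qed simp
  \<comment> \<open>The total mass of \<open>mean_ptail 1\<close> is the scaled mean, here 1, which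
    gives \<open>c_eq\<close>. The next two masses, \<open>\<rho>\<^sub>2 / 2\<close> and
    \<open>\<rho>\<^sub>3 / 6\<close>, serve as \<open>m\<close> and \<open>M\<close>.\<close>
  interpret critical_weights "mean_ptail 0" "mean_ptail (Suc 0)" "mean_ptail 2" "mean_ptail 3"
    "scaled_moment A \<mu> 2 / 2" "\<integral>x. (\<mu> * x) ^ 3 / fact 3 \<partial>A"
  proof
    show "mean_ptail 2 k = 1 - (\<Sum>i\<le>k. mean_ptail (Suc 0) i)" for k
      using mean_ptail_Suc[of 1 k] int1 mean by (simp add: numeral_2_eq_2)
    show "mean_ptail 3 k = scaled_moment A \<mu> 2 / 2 - (\<Sum>i\<le>k. mean_ptail 2 i)" for k
    proof -
      have "(\<integral>x. (\<mu> * x) ^ 2 / fact 2 \<partial>A) = scaled_moment A \<mu> 2 / 2"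
        by (simp add: scaled_moment_def power_mult_distrib)
      then show ?thesis
        using mean_ptail_Suc[OF int2, of k] by (simp add: numeral_3_eq_3 numeral_2_eq_2)
    qed
    show "(\<Sum>i\<le>k. mean_ptail 3 i) \<le> (\<integral>x. (\<mu> * x) ^ 3 / fact 3 \<partial>A)" for k
      by (rule sum_mean_ptail_le[OF int3])
  qed (rule mean_ptail_nonneg)+
  show ?thesis
    using inverse_sum_p_bigo by (simp add: loss_prob_eq mult.commute)
qed

end

theorem theorem3p2:
  fixes A :: "real measure" and lam \<mu> \<rho> :: real
  assumes "real_distribution A"
    and "AE x in A. 0 \<le> x"
    and "0 < lam"
    and "integrable A (\<lambda>x. x)" and "(\<integral>x. x \<partial>A) = 1 / lam"
    and "0 < \<mu>"
    and "\<rho> = lam / \<mu>"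
    and "\<rho> = 1"
    and "integrable A (\<lambda>x. x ^ 3)"
  shows "(\<lambda>n::nat. loss_prob A \<mu> n - scaled_moment A \<mu> 2 / (2 * real n))
           \<in> O(\<lambda>n. ln (real n) / (real n)\<^sup>2)"
proof -
  interpret real_distribution A by fact
  interpret interarrival A \<mu>
    using assms by unfold_locales auto
  have "\<mu> = lam"
    using assms by (simp add: field_simps)
  then have "(\<lambda>n. loss_prob A \<mu> n - scaled_moment A \<mu> 2 / (2 * real n)) \<in> O(\<lambda>n. 1 / (real n)\<^sup>2)"
    using assms by (intro loss_prob_critical_bigo) auto
  \<comment> \<open>For \<open>n \<ge> 3\<close> one has \<open>ln n \<ge> 1\<close>, as
    \<open>exp 1 \<le> 3\<close>, so the sharper error \<open>1 / n^2\<close> is absorbed.\<close>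
  also have "(\<lambda>n. 1 / (real n)\<^sup>2) \<in> O(\<lambda>n. ln (real n) / (real n)\<^sup>2)"
  proof (rule bigoI[where c = 1], rule eventually_sequentiallyI[of 3])
    fix n :: nat assume n: "3 \<le> n"
    then have "1 \<le> ln (real n)"
      using exp_le by (subst ln_ge_iff) auto
    then show "norm (1 / (real n)\<^sup>2) \<le> 1 * norm (ln (real n) / (real n)\<^sup>2)"
      by (simp add: divide_right_mono)
  qed
  finally show ?thesis .
qed

end
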